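(* Let $Q$ be the quiver of type $X_6$ with vertices $v_0,\dots,v_5$ and arrows $v_1\Rightarrow v_2$, $v_3\Rightarrow v_4$ (double arrows), $v_0\to v_1$, $v_2\to v_0$, $v_0\to v_3$, $v_4\to v_0$, and a single arrow $v_0\to v_5$ (so $v_5$ is a leaf). Then an integer vector $\boldsymbol b=(b_0,\dots,b_5)$ is admissible for $Q$ if and only if $b_5=-2b_0>0$ and $b_1=b_2=b_3=b_4=0$.
   Context: Quivers have no loops/2-cycles; $b_{ij}$ is the number of arrows $v_i\to v_j$ (negative if reversed); mutation $\mu_k$: $b'_{ij}=-b_{ij}$ if $k\in\{i,j\}$, else $b'_{ij}=b_{ij}+\mathrm{sgn}(b_{ik})[b_{ik}b_{kj}]_+$. For a quiver $Q$ on mutable vertices and an integer vector $\boldsymbol b$ indexed by them, add a frozen vertex $q$ with $b_i$ arrows from $v_i$ to $q$ (negative meaning arrows from $q$); mutations only at mutable vertices. $\boldsymbol b$ is admissible if $\boldsymbol b\neq0$ and the resulting quiver with frozen vertex has finite mutation class. *)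

theory Defs
  imports Main
begin

text \<open>
  A quiver without loops and 2-cycles on the vertex type \<open>'v\<close> is its skew-symmetric
  exchange matrix: \<open>B i j\<close> is the number of arrows from \<open>i\<close> to \<open>j\<close>, counted negatively
  if they go from \<open>j\<close> to \<open>i\<close>.
\<close>

type_synonym 'v quiver = "'v \<Rightarrow> 'v \<Rightarrow> int"

definition is_quiver :: "'v quiver \<Rightarrow> bool" where
  "is_quiver B \<longleftrightarrow> (\<forall>i j. B i j = - B j i)"

definition mutate :: "'v \<Rightarrow> 'v quiver \<Rightarrow> 'v quiver" where
  "mutate k B = (\<lambda>i j. if k = i \<or> k = j then - B i j
                       else B i j + sgn (B i k) * max 0 (B i k * B k j))"

text \<open>
  The mutation class consists of labelled quivers. On a finite vertex set it is finite
  iff it is finite up to isomorphism, since an isomorphism class contains only finitely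
  many labelled quivers.
\<close>

inductive_set mutation_class :: "'v set \<Rightarrow> 'v quiver \<Rightarrow> 'v quiver set"
  for M :: "'v set" and B :: "'v quiver"
  where
    base: "B \<in> mutation_class M B"
  | step: "C \<in> mutation_class M B \<Longrightarrow> k \<in> M \<Longrightarrow> mutate k C \<in> mutation_class M B"

text \<open>The frozen vertex is \<open>None\<close>; the mutable vertices are the \<open>Some v\<close>.\<close>

fun add_frozen :: "'v quiver \<Rightarrow> ('v \<Rightarrow> int) \<Rightarrow> 'v option quiver" where
  "add_frozen B b (Some i) (Some j) = B i j"
| "add_frozen B b (Some i) None = b i"
| "add_frozen B b None (Some j) = - b j"
| "add_frozen B b None None = 0"

definition admissible :: "('v::finite) quiver \<Rightarrow> ('v \<Rightarrow> int) \<Rightarrow> bool" where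
  "admissible B b \<longleftrightarrow>
     b \<noteq> (\<lambda>_. 0) \<and> finite (mutation_class (range Some) (add_frozen B b))"

datatype X6_vertex = V0 | V1 | V2 | V3 | V4 | V5

lemma UNIV_X6_vertex: "UNIV = {V0, V1, V2, V3, V4, V5}"
proof -
  have "v \<in> {V0, V1, V2, V3, V4, V5}" for v
    by (cases v) simp_all
  then show ?thesis by blast
qed

instance X6_vertex :: finite
  by standard (simp add: UNIV_X6_vertex)

fun X6_arrows :: "X6_vertex \<Rightarrow> X6_vertex \<Rightarrow> nat" where
  "X6_arrows V1 V2 = 2"
| "X6_arrows V3 V4 = 2"
| "X6_arrows V0 V1 = 1"
| "X6_arrows V2 V0 = 1"
| "X6_arrows V0 V3 = 1"
| "X6_arrows V4 V0 = 1"
| "X6_arrows V0 V5 = 1"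
| "X6_arrows _ _ = 0"

definition X6 :: "X6_vertex quiver" where
  "X6 i j = int (X6_arrows i j) - int (X6_arrows j i)"

lemma is_quiver_X6: "is_quiver X6"
  by (simp add: is_quiver_def X6_def)

lemma is_quiver_add_frozen:
  assumes "is_quiver B"
  shows "is_quiver (add_frozen B b)"
  unfolding is_quiver_def
proof (intro allI)
  fix i j
  show "add_frozen B b i j = - add_frozen B b j i"
  proof (cases i; cases j)
    fix u v assume "i = Some u" "j = Some v"
    moreover have "B u v = - B v u"
      using assms unfolding is_quiver_def by blast
    ultimately show ?thesis by simp
  qed simp_all
qed

lemma is_quiver_mutate:
  assumes "is_quiver B"
  shows "is_quiver (mutate k B)"
  unfolding is_quiver_def
proof (intro allI)
  fix i j
  have skew: "B i j = - B j i" "B i k = - B k i" "B k j = - B j k"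
    using assms unfolding is_quiver_def by blast+
  have "sgn x * max 0 (x * y) = sgn y * max 0 (x * y)" for x y :: int
  proof (cases "x * y > 0")
    case True
    then show ?thesis by (auto simp: zero_less_mult_iff)
  qed simp
  from this[of "B k i" "B j k"]
  have "sgn (B i k) * max 0 (B i k * B k j) = - (sgn (B j k) * max 0 (B j k * B k i))"
    unfolding skew(2,3) by (simp add: mult.commute)
  with skew(1) show "mutate k B i j = - mutate k B j i"
    unfolding mutate_def by presburger
qed

end

theory Submission
  imports Defs
begin

text \<open>
  A double arrow \<open>i \<Rightarrow> j\<close> forces \<open>b i = - b j \<le> 0\<close>: otherwise mutating alternately at its two ends
  makes the arrows to the frozen vertex grow linearly. Applying this to \<open>X6\<close> and to the quivers
  reached by mutating at \<open>V0, V1, V2\<close> and at \<open>V0, V3, V4\<close> leaves only the claimed vectors. Conversely,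
  up to a positive factor on the frozen row, the claimed vectors extend \<open>X6\<close> to the quiver \<open>X7\<close>,
  whose mutation class consists of two quivers up to isomorphism.
\<close>

section \<open>Double arrows in a finite mutation class\<close>

lemma is_quiver_mutation_class:
  assumes "is_quiver B" "C \<in> mutation_class M B"
  shows "is_quiver C"
  using assms(2) by induction (auto simp: assms(1) is_quiver_mutate)

lemma mutate_apply:
  "mutate k B i j = (if k = i \<or> k = j then - B i j else B i j + sgn (B i k) * max 0 (B i k * B k j))"
  by (simp add: mutate_def)

lemma is_quiver_skew:
  assumes "is_quiver B"
  shows "B i j = - B j i"
  using assms unfolding is_quiver_def by blast

text \<open>The double arrow is reversed, so \<open>i\<close> and \<open>j\<close> exchange roles;
  each path q -> i => j adds two arrows from \<open>q\<close> to \<open>j\<close>.\<close>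

lemma double_arrow_mutate_source:
  assumes "is_quiver C" "C i j = 2" "q \<noteq> i" "q \<noteq> j"
  shows "mutate i C j i = 2"
    and "mutate i C i q = - C i q"
    and "mutate i C j q = C j q + min 0 (2 * C i q)"
proof -
  have ji: "C j i = - 2" and ij: "i \<noteq> j"
    using is_quiver_skew[OF assms(1), of j i] is_quiver_skew[OF assms(1), of i i] assms(2)
    by auto
  show "mutate i C j i = 2" "mutate i C i q = - C i q"
    "mutate i C j q = C j q + min 0 (2 * C i q)"
    using ji ij assms(3,4) by (auto simp: mutate_def)
qed

lemma double_arrow_mutate_target:
  assumes "is_quiver C" "C i j = 2" "q \<noteq> i" "q \<noteq> j"
  shows "mutate j C j i = 2"
    and "mutate j C j q = - C j q"
    and "mutate j C i q = C i q + max 0 (2 * C j q)"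
proof -
  have ji: "C j i = - 2" and ij: "i \<noteq> j"
    using is_quiver_skew[OF assms(1), of j i] is_quiver_skew[OF assms(1), of i i] assms(2)
    by auto
  show "mutate j C j i = 2" "mutate j C j q = - C j q"
    "mutate j C i q = C i q + max 0 (2 * C j q)"
    using ji ij assms(2-4) by (auto simp: mutate_def)
qed

locale finite_mutation_class =
  fixes M :: "'v set" and B :: "'v quiver" and q :: 'v
  assumes quiver: "is_quiver B"
    and finite_class: "finite (mutation_class M B)"
    and finite_mutable: "finite M"
    and frozen: "q \<notin> M"
begin

lemma frozen_row_bounded:
  "\<exists>N::nat. \<forall>C \<in> mutation_class M B. \<forall>i \<in> M. \<bar>C i q\<bar> \<le> int N"
proof -
  let ?S = "(\<lambda>(C, i). \<bar>C i q\<bar>) ` (mutation_class M B \<times> M)"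
  have fin: "finite ?S"
    using finite_class finite_mutable by blast
  \<comment> \<open>\<open>insert 0\<close> keeps the argument of \<open>Max\<close> nonempty even
    for empty \<open>M\<close>.\<close>
  have "\<bar>C i q\<bar> \<le> int (nat (Max (insert 0 ?S)))" if "C \<in> mutation_class M B" "i \<in> M" for C i
  proof -
    have "\<bar>C i q\<bar> \<in> ?S" using that by force
    then have "\<bar>C i q\<bar> \<le> Max (insert 0 ?S)" using fin by (intro Max_ge) auto
    then show ?thesis by linarith
  qed
  then show ?thesis by blast
qed

text \<open>Mutation at the source keeps the sum \<open>C i q + C j q\<close>, and the entry at the
  new source is the old source entry plus this sum. If both were negative, alternating mutations
  would make the source entry decrease forever.\<close>

lemma double_arrow_source_nonneg_or_sum_nonneg:
  assumes "C \<in> mutation_class M B" "i \<in> M" "j \<in> M" "C i j = 2" "C i q < 0"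
  shows "0 \<le> C i q + C j q"
proof (rule ccontr)
  assume sum: "\<not> 0 \<le> C i q + C j q"
  \<comment> \<open>The ends \<open>i\<close> and \<open>j\<close> are chosen anew for every
    \<open>n\<close>, since each mutation swaps source and target.\<close>
  have "\<exists>D i j. D \<in> mutation_class M B \<and> i \<in> M \<and> j \<in> M \<and> D i j = 2 \<and>
      D i q \<le> - int n \<and> D i q < 0 \<and> D i q + D j q < 0" for n
  proof (induction n)
    case 0
    then show ?case using assms sum by (intro exI[of _ C] exI[of _ i] exI[of _ j]) auto
  next
    case (Suc n)
    then obtain D i j where D: "D \<in> mutation_class M B" "i \<in> M" "j \<in> M" "D i j = 2"
      "D i q \<le> - int n" "D i q < 0" "D i q + D j q < 0" by blast
    have "is_quiver D" using is_quiver_mutation_class[OF quiver D(1)] .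
    moreover have "q \<noteq> i" "q \<noteq> j" using D frozen by auto
    ultimately show ?case
      using D double_arrow_mutate_source[of D i j q] mutation_class.step[OF D(1,2)]
      by (intro exI[of _ "mutate i D"] exI[of _ j] exI[of _ i]) auto
  qed
  note unbounded = this
  obtain N :: nat where N: "\<forall>C \<in> mutation_class M B. \<forall>i \<in> M. \<bar>C i q\<bar> \<le> int N"
    using frozen_row_bounded by blast
  from unbounded[of "Suc N"] N show False by force
qed

text \<open>Dually, mutation at the target keeps the sum and adds it to the target entry, which
  would grow forever if both were positive.\<close>

lemma double_arrow_target_nonpos_or_sum_nonpos:
  assumes "C \<in> mutation_class M B" "i \<in> M" "j \<in> M" "C i j = 2" "0 < C j q"
  shows "C i q + C j q \<le> 0"
proof (rule ccontr)
  assume sum: "\<not> C i q + C j q \<le> 0"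
  have "\<exists>D i j. D \<in> mutation_class M B \<and> i \<in> M \<and> j \<in> M \<and> D i j = 2 \<and>
      int n \<le> D j q \<and> 0 < D j q \<and> 0 < D i q + D j q" for n
  proof (induction n)
    case 0
    then show ?case using assms sum by (intro exI[of _ C] exI[of _ i] exI[of _ j]) auto
  next
    case (Suc n)
    then obtain D i j where D: "D \<in> mutation_class M B" "i \<in> M" "j \<in> M" "D i j = 2"
      "int n \<le> D j q" "0 < D j q" "0 < D i q + D j q" by blast
    have "is_quiver D" using is_quiver_mutation_class[OF quiver D(1)] .
    moreover have "q \<noteq> i" "q \<noteq> j" using D frozen by auto
    ultimately show ?case
      using D double_arrow_mutate_target[of D i j q] mutation_class.step[OF D(1,3)]
      by (intro exI[of _ "mutate j D"] exI[of _ j] exI[of _ i]) auto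
  qed
  note unbounded = this
  obtain N :: nat where N: "\<forall>C \<in> mutation_class M B. \<forall>i \<in> M. \<bar>C i q\<bar> \<le> int N"
    using frozen_row_bounded by blast
  from unbounded[of "Suc N"] N show False by force
qed

text \<open>Unless \<open>0 \<le> C i q\<close> and \<open>C j q \<le> 0\<close>, the two
  inequalities above force the sum to vanish.\<close>

lemma double_arrow_balanced:
  assumes "C \<in> mutation_class M B" "i \<in> M" "j \<in> M" "C i j = 2"
  shows "C j q = - C i q \<and> C i q \<le> 0"
proof -
  have quiverC: "is_quiver C" and ne: "q \<noteq> i" "q \<noteq> j"
    using is_quiver_mutation_class[OF quiver assms(1)] assms(2,3) frozen by auto
  note source = double_arrow_mutate_source[OF quiverC assms(4) ne]
  note target = double_arrow_mutate_target[OF quiverC assms(4) ne]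
  note step = mutation_class.step[OF assms(1)]
  have 1: "C i q < 0 \<Longrightarrow> 0 \<le> C i q + C j q"
    and 2: "0 < C j q \<Longrightarrow> C i q + C j q \<le> 0"
    using double_arrow_source_nonneg_or_sum_nonneg double_arrow_target_nonpos_or_sum_nonpos assms
    by blast+
  \<comment> \<open>In the remaining case a mutation at one end leaves the entry at the other end
    unchanged, but turns the target into a source or the source into a target. The same inequalities
    then make both entries zero.\<close>
  have 3: "mutate i C j q < 0 \<Longrightarrow> 0 \<le> mutate i C j q + mutate i C i q"
    by (rule double_arrow_source_nonneg_or_sum_nonneg[OF step[OF assms(2)] assms(3,2) source(1)])
  have 4: "0 < mutate j C i q \<Longrightarrow> mutate j C j q + mutate j C i q \<le> 0"
    by (rule double_arrow_target_nonpos_or_sum_nonpos[OF step[OF assms(3)] assms(3,2) target(1)])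
  show ?thesis using 1 2 3 4 source target by linarith
qed

end

section \<open>Mutation of the frozen row\<close>

definition mutate_row :: "'v \<Rightarrow> 'v quiver \<Rightarrow> ('v \<Rightarrow> int) \<Rightarrow> 'v \<Rightarrow> int" where
  "mutate_row k B b i = (if k = i then - b i else b i + sgn (B i k) * max 0 (B i k * b k))"

text \<open>The mutable part evolves independently of \<open>b\<close>, so quiver and vector can be
  computed separately.\<close>

lemma mutate_add_frozen:
  assumes "is_quiver B"
  shows "mutate (Some k) (add_frozen B b) = add_frozen (mutate k B) (mutate_row k B b)"
proof (intro ext)
  fix x y
  have None_row: "mutate (Some k) (add_frozen B b) (Some i) None = mutate_row k B b i" for i
    by (simp add: mutate_def mutate_row_def)
  \<comment> \<open>Skew-symmetry of the mutated quiver reduces the entries in row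
    \<open>None\<close> to those given by \<open>None_row\<close>.\<close>
  have quiv: "is_quiver (mutate (Some k) (add_frozen B b))"
    by (intro is_quiver_mutate is_quiver_add_frozen assms)
  show "mutate (Some k) (add_frozen B b) x y = add_frozen (mutate k B) (mutate_row k B b) x y"
  proof (cases x; cases y)
    fix i assume "x = None" "y = Some i"
    then show ?thesis
      using None_row[of i] is_quiver_skew[OF quiv, of None "Some i"] by simp
  next
    assume "x = None" "y = None"
    then show ?thesis
      using is_quiver_skew[OF quiv, of None None] by simp
  qed (simp_all add: None_row, simp add: mutate_def)
qed

text \<open>The sign factor depends on \<open>B\<close> alone, and a positive \<open>c\<close>
  passes through \<open>max 0\<close>.\<close>

lemma mutate_row_scale:
  assumes "0 < c"
  shows "mutate_row k B (\<lambda>i. c * b i) = (\<lambda>i. c * mutate_row k B b i)"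
proof
  fix i
  have "max 0 (B i k * (c * b k)) = c * max 0 (B i k * b k)"
    using assms by (simp add: max_mult_distrib_left mult.left_commute)
  then show "mutate_row k B (\<lambda>i. c * b i) i = c * mutate_row k B b i"
    by (simp add: mutate_row_def algebra_simps)
qed

text \<open>The same sequence of mutations, run on \<open>b\<close> and on its multiple, keeps the
  two vectors proportional.\<close>

lemma mutation_class_add_frozen_scale:
  assumes "is_quiver B" "0 < c"
    and "C \<in> mutation_class (range Some) (add_frozen B (\<lambda>i. c * b i))"
  shows "\<exists>B' b'. is_quiver B' \<and> C = add_frozen B' (\<lambda>i. c * b' i) \<and>
    add_frozen B' b' \<in> mutation_class (range Some) (add_frozen B b)"
  using assms(3)
proof induction
  case base
  then show ?case using assms(1) mutation_class.base by blast
next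
  case (step C k)
  then obtain B' b' v where *: "is_quiver B'" "C = add_frozen B' (\<lambda>i. c * b' i)" "k = Some v"
    "add_frozen B' b' \<in> mutation_class (range Some) (add_frozen B b)"
    by blast
  have "add_frozen (mutate v B') (mutate_row v B' b') \<in>
      mutation_class (range Some) (add_frozen B b)"
    using mutation_class.step[OF *(4), of "Some v"] mutate_add_frozen[OF *(1)] by simp
  moreover have "mutate k C = add_frozen (mutate v B') (\<lambda>i. c * mutate_row v B' b' i)"
    unfolding *(2,3) mutate_add_frozen[OF *(1)] mutate_row_scale[OF assms(2)] ..
  ultimately show ?case
    using is_quiver_mutate[OF *(1)] by blast
qed

lemma finite_mutation_class_add_frozen_scale:
  assumes "is_quiver B" "0 < c"
    and "finite (mutation_class (range Some) (add_frozen B b))"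
  shows "finite (mutation_class (range Some) (add_frozen B (\<lambda>i. c * b i)))"
proof (rule finite_surj[OF assms(3)])
  let ?scale = "\<lambda>C. add_frozen (\<lambda>i j. C (Some i) (Some j)) (\<lambda>i. c * C (Some i) None)"
  show "mutation_class (range Some) (add_frozen B (\<lambda>i. c * b i)) \<subseteq>
      ?scale ` mutation_class (range Some) (add_frozen B b)"
  proof
    fix C assume "C \<in> mutation_class (range Some) (add_frozen B (\<lambda>i. c * b i))"
    then obtain B' b' where "C = add_frozen B' (\<lambda>i. c * b' i)"
      and in_class: "add_frozen B' b' \<in> mutation_class (range Some) (add_frozen B b)"
      using mutation_class_add_frozen_scale[OF assms(1,2)] by blast
    then have "C = ?scale (add_frozen B' b')" by simp
    then show "C \<in> ?scale ` mutation_class (range Some) (add_frozen B b)"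
      using in_class by (rule image_eqI)
  qed
qed

section \<open>The mutation class of X7\<close>

definition rename :: "('v \<Rightarrow> 'v) \<Rightarrow> 'v quiver \<Rightarrow> 'v quiver" where
  "rename f B = (\<lambda>i j. B (f i) (f j))"

lemma mutate_rename:
  assumes "inj f"
  shows "mutate k (rename f B) = rename f (mutate (f k) B)"
  unfolding mutate_def rename_def by (simp add: inj_eq[OF assms])

lemma rename_rename: "rename f (rename g B) = rename (g \<circ> f) B"
  by (simp add: rename_def)

lemma rename_apply: "rename f B i j = B (f i) (f j)"
  by (simp add: rename_def)

text \<open>Mutating a copy relabelled by \<open>f\<close> at \<open>k\<close> is mutating the
  original at \<open>f k\<close>, so every quiver of the class is a relabelled member of
  \<open>S\<close>. A finite vertex type has only finitely many relabellings.\<close>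

lemma finite_mutation_class_renaming:
  fixes B :: "('v::finite) quiver"
  assumes "finite S" "B \<in> S"
    and closed: "\<And>C k. C \<in> S \<Longrightarrow> \<exists>f D. inj f \<and> D \<in> S \<and> mutate k C = rename f D"
  shows "finite (mutation_class M B)"
proof (rule finite_subset)
  show "mutation_class M B \<subseteq> (\<lambda>(f, C). rename f C) ` ({f. inj f} \<times> S)"
  proof
    fix C assume "C \<in> mutation_class M B"
    then show "C \<in> (\<lambda>(f, C). rename f C) ` ({f. inj f} \<times> S)"
    proof induction
      case base
      have "B = rename id B" by (simp add: rename_def)
      then show ?case using assms(2) by (intro image_eqI[of _ _ "(id, B)"]) simp_all
    next
      case (step C k)
      then obtain f D where f: "inj f" "D \<in> S" "C = rename f D" by auto
      obtain g E where g: "inj g" "E \<in> S" "mutate (f k) D = rename g E"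
        using closed[OF f(2)] by blast
      have "mutate k C = rename (g \<circ> f) E"
        using f g by (simp add: mutate_rename rename_rename)
      then show ?case using inj_compose[OF g(1) f(1)] g(2) by force
    qed
  qed
  show "finite ((\<lambda>(f, C). rename f C) ` ({f. inj f} \<times> S))"
    using assms(1) by simp
qed

section \<open>The two quivers of the class and their mutations\<close>

definition X7_row :: "X6_vertex \<Rightarrow> int" where
  "X7_row = (\<lambda>_. 0)(V0 := - 1, V5 := 2)"

definition X7 :: "X6_vertex option quiver" where
  "X7 = add_frozen X6 X7_row"

definition X7_mutated :: "X6_vertex option quiver" where
  "X7_mutated = mutate (Some V0) X7"

text \<open>Values are listed at \<open>V0\<close> to \<open>V5\<close> and then at
  \<open>None\<close>; this encodes both matrix rows and relabellings.\<close>

definition tabulate :: "'a \<Rightarrow> 'a \<Rightarrow> 'a \<Rightarrow> 'a \<Rightarrow> 'a \<Rightarrow> 'a \<Rightarrow> 'a \<Rightarrow> X6_vertex option \<Rightarrow> 'a" where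
  "tabulate a0 a1 a2 a3 a4 a5 a v = (case v of None \<Rightarrow> a
     | Some u \<Rightarrow> (case u of V0 \<Rightarrow> a0 | V1 \<Rightarrow> a1 | V2 \<Rightarrow> a2 | V3 \<Rightarrow> a3 | V4 \<Rightarrow> a4 | V5 \<Rightarrow> a5))"

lemma tabulate_simps [simp]:
  "tabulate a0 a1 a2 a3 a4 a5 a None = a"
  "tabulate a0 a1 a2 a3 a4 a5 a (Some V0) = a0"
  "tabulate a0 a1 a2 a3 a4 a5 a (Some V1) = a1"
  "tabulate a0 a1 a2 a3 a4 a5 a (Some V2) = a2"
  "tabulate a0 a1 a2 a3 a4 a5 a (Some V3) = a3"
  "tabulate a0 a1 a2 a3 a4 a5 a (Some V4) = a4"
  "tabulate a0 a1 a2 a3 a4 a5 a (Some V5) = a5"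
  by (simp_all add: tabulate_def)

lemma all_X6_vertex: "(\<forall>v. P v) \<longleftrightarrow> P V0 \<and> P V1 \<and> P V2 \<and> P V3 \<and> P V4 \<and> P V5"
  using X6_vertex.exhaust[of v "P v" for v] by auto

lemma all_X6_vertex_option:
  "(\<forall>v. P v) \<longleftrightarrow> P None \<and> P (Some V0) \<and> P (Some V1) \<and> P (Some V2) \<and> P (Some V3) \<and>
    P (Some V4) \<and> P (Some V5)"
  unfolding split_option_all all_X6_vertex ..

lemma inj_tabulate:
  assumes "distinct [a0, a1, a2, a3, a4, a5, a]"
  shows "inj (tabulate a0 a1 a2 a3 a4 a5 a)"
  using assms unfolding inj_def all_X6_vertex_option by auto

lemma X7_matrix: "X7 = tabulate
     (tabulate 0 1 (- 1) 1 (- 1) 1 (- 1))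
     (tabulate (- 1) 0 2 0 0 0 0)
     (tabulate 1 (- 2) 0 0 0 0 0)
     (tabulate (- 1) 0 0 0 2 0 0)
     (tabulate 1 0 0 (- 2) 0 0 0)
     (tabulate (- 1) 0 0 0 0 0 2)
     (tabulate 1 0 0 0 0 (- 2) 0)"
  unfolding fun_eq_iff all_X6_vertex_option by (simp add: X7_def X7_row_def X6_def)

lemmas X7_entries = X7_matrix[unfolded fun_eq_iff all_X6_vertex_option tabulate_simps]

lemma X7_mutated_matrix: "X7_mutated = tabulate
     (tabulate 0 (- 1) 1 (- 1) 1 (- 1) 1)
     (tabulate 1 0 1 0 (- 1) 0 (- 1))
     (tabulate (- 1) (- 1) 0 1 0 1 0)
     (tabulate 1 0 (- 1) 0 1 0 (- 1))
     (tabulate (- 1) 1 0 (- 1) 0 1 0)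
     (tabulate 1 0 (- 1) 0 (- 1) 0 1)
     (tabulate (- 1) 1 0 1 0 (- 1) 0)"
  unfolding fun_eq_iff all_X6_vertex_option by (simp add: X7_mutated_def mutate_apply X7_entries)

lemmas X7_mutated_entries =
  X7_mutated_matrix[unfolded fun_eq_iff all_X6_vertex_option tabulate_simps]

text \<open>Mutating at either end of the double arrow in a triangle such as V0 -> V1 => V2 -> V0
  gives the same triangle with these two ends exchanged. The vertex \<open>None\<close> behaves like
  the others here.\<close>

lemma mutate_X7:
  "mutate (Some V1) X7 =
    rename (tabulate (Some V0) (Some V2) (Some V1) (Some V3) (Some V4) (Some V5) None) X7"
  "mutate (Some V2) X7 =
    rename (tabulate (Some V0) (Some V2) (Some V1) (Some V3) (Some V4) (Some V5) None) X7"
  "mutate (Some V3) X7 =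
    rename (tabulate (Some V0) (Some V1) (Some V2) (Some V4) (Some V3) (Some V5) None) X7"
  "mutate (Some V4) X7 =
    rename (tabulate (Some V0) (Some V1) (Some V2) (Some V4) (Some V3) (Some V5) None) X7"
  "mutate (Some V5) X7 =
    rename (tabulate (Some V0) (Some V1) (Some V2) (Some V3) (Some V4) None (Some V5)) X7"
  "mutate None X7 =
    rename (tabulate (Some V0) (Some V1) (Some V2) (Some V3) (Some V4) None (Some V5)) X7"
  unfolding fun_eq_iff all_X6_vertex_option
  by (simp_all add: rename_apply mutate_apply X7_entries)

text \<open>The vertices other than \<open>V0\<close> form the pairs V1, V2 and V3, V4 and V5, None.
  After mutation at one member of a pair its partner takes over the role of \<open>V0\<close>: the
  permutation sends the partner to \<open>Some V0\<close>.\<close>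

lemma mutate_X7_mutated:
  "mutate (Some V1) X7_mutated =
    rename (tabulate (Some V1) (Some V2) (Some V0) (Some V4) (Some V5) None (Some V3)) X7_mutated"
  "mutate (Some V2) X7_mutated =
    rename (tabulate (Some V2) (Some V0) (Some V1) (Some V4) (Some V5) None (Some V3)) X7_mutated"
  "mutate (Some V3) X7_mutated =
    rename (tabulate (Some V1) (Some V4) (Some V5) (Some V2) (Some V0) None (Some V3)) X7_mutated"
  "mutate (Some V4) X7_mutated =
    rename (tabulate (Some V2) (Some V4) (Some V5) (Some V0) (Some V1) None (Some V3)) X7_mutated"
  "mutate (Some V5) X7_mutated =
    rename (tabulate (Some V1) (Some V4) (Some V5) None (Some V3) (Some V2) (Some V0)) X7_mutated"
  "mutate None X7_mutated =
    rename (tabulate (Some V2) (Some V4) (Some V5) None (Some V3) (Some V0) (Some V1)) X7_mutated"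
  unfolding fun_eq_iff all_X6_vertex_option
  by (simp_all add: rename_apply mutate_apply X7_mutated_entries)

lemma mutate_V0_X7_mutated: "mutate (Some V0) X7_mutated = X7"
  unfolding fun_eq_iff all_X6_vertex_option
  by (simp add: mutate_apply X7_mutated_entries X7_entries)

lemma finite_mutation_class_X7: "finite (mutation_class M X7)"
proof (rule finite_mutation_class_renaming)
  \<comment> \<open>\<open>relabelled\<close> serves the mutations away from \<open>V0\<close>,
    \<open>same\<close> the two at \<open>V0\<close>, which interchange the quivers.\<close>
  have relabelled: "\<exists>f E. inj f \<and> E \<in> S \<and> rename (tabulate a0 a1 a2 a3 a4 a5 a) D = rename f E"
    if "distinct [a0, a1, a2, a3, a4, a5, a]" "D \<in> S"
    for a0 a1 a2 a3 a4 a5 a :: "X6_vertex option" and D S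
    using inj_tabulate[OF that(1)] that(2) by blast
  have same: "\<exists>f E. inj f \<and> E \<in> S \<and> D = rename f E" if "D \<in> S"
    for D :: "X6_vertex option quiver" and S
    using that by (intro exI[of _ id] exI[of _ D]) (simp add: rename_def)
  have "\<forall>k. \<exists>f D. inj f \<and> D \<in> {X7, X7_mutated} \<and> mutate k X7 = rename f D"
    unfolding all_X6_vertex_option mutate_X7 X7_mutated_def[symmetric]
    by (intro conjI; (rule relabelled; simp | rule same; simp))
  moreover have "\<forall>k. \<exists>f D. inj f \<and> D \<in> {X7, X7_mutated} \<and> mutate k X7_mutated = rename f D"
    unfolding all_X6_vertex_option mutate_X7_mutated mutate_V0_X7_mutated
    by (intro conjI; (rule relabelled; simp | rule same; simp))
  ultimately show "\<exists>f D. inj f \<and> D \<in> {X7, X7_mutated} \<and> mutate k C = rename f D"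
    if "C \<in> {X7, X7_mutated}" for C k
    using that by (elim insertE emptyE) simp_all
qed simp_all

section \<open>Admissible vectors for X6\<close>

theorem theorem6p2:
  fixes b :: "X6_vertex \<Rightarrow> int"
  shows "admissible X6 b \<longleftrightarrow>
    b V5 = - 2 * b V0 \<and> - 2 * b V0 > 0 \<and> b V1 = 0 \<and> b V2 = 0 \<and> b V3 = 0 \<and> b V4 = 0"
proof
  assume adm: "admissible X6 b"
  interpret finite_mutation_class "range Some" "add_frozen X6 b" None
    using adm is_quiver_add_frozen[OF is_quiver_X6]
    by unfold_locales (auto simp: admissible_def)
  have balanced: "C (Some j) None = - C (Some i) None \<and> C (Some i) None \<le> 0"
    if "C \<in> mutation_class (range Some) (add_frozen X6 b)" "C (Some i) (Some j) = 2" for C i j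
    using double_arrow_balanced that by blast
  have 12: "b V2 = - b V1 \<and> b V1 \<le> 0"
    using balanced[OF mutation_class.base, of V1 V2] by (simp add: X6_def)
  have 34: "b V4 = - b V3 \<and> b V3 \<le> 0"
    using balanced[OF mutation_class.base, of V3 V4] by (simp add: X6_def)
  have mutated_balanced: "c j = - c i \<and> c i \<le> 0"
    if "mutate w (mutate v (mutate u X6)) i j = 2"
      and "c = mutate_row w (mutate v (mutate u X6)) (mutate_row v (mutate u X6) (mutate_row u X6 b))"
    for u v w i j c
  proof -
    have "mutate (Some w) (mutate (Some v) (mutate (Some u) (add_frozen X6 b))) =
        add_frozen (mutate w (mutate v (mutate u X6))) c"
      by (simp add: mutate_add_frozen is_quiver_mutate is_quiver_X6 that(2))
    moreover have "mutate (Some w) (mutate (Some v) (mutate (Some u) (add_frozen X6 b)))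
        \<in> mutation_class (range Some) (add_frozen X6 b)"
      by (intro mutation_class.intros rangeI)
    ultimately show ?thesis
      using balanced[of _ i j] that(1) by fastforce
  qed
  \<comment> \<open>Mutating at \<open>V0\<close>, \<open>V1\<close>, \<open>V2\<close> creates a
    double arrow V4 => V5. By the symmetry of \<open>X6\<close> that swaps the two triangles,
    mutating at \<open>V0\<close>, \<open>V3\<close>, \<open>V4\<close> creates V2 => V5.\<close>
  define c where "c =
    mutate_row V2 (mutate V1 (mutate V0 X6)) (mutate_row V1 (mutate V0 X6) (mutate_row V0 X6 b))"
  define d where "d =
    mutate_row V4 (mutate V3 (mutate V0 X6)) (mutate_row V3 (mutate V0 X6) (mutate_row V0 X6 b))"
  have "c V5 = - c V4 \<and> c V4 \<le> 0"
    by (rule mutated_balanced[OF _ c_def]) (simp add: mutate_apply X6_def)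
  moreover have "c V4 = b V4 + 2 * max 0 (b V0)" "c V5 = b V5 - 2 * max 0 (- b V0)"
    using 12 by (auto simp: c_def mutate_row_def mutate_apply X6_def max_def)
  moreover have "d V5 = - d V2 \<and> d V2 \<le> 0"
    by (rule mutated_balanced[OF _ d_def]) (simp add: mutate_apply X6_def)
  moreover have "d V2 = b V2 + 2 * max 0 (b V0)"
    using 34 by (auto simp: d_def mutate_row_def mutate_apply X6_def max_def)
  moreover have "b \<noteq> (\<lambda>_. 0)"
    using adm unfolding admissible_def by blast
  then have "b V0 \<noteq> 0 \<or> b V1 \<noteq> 0 \<or> b V2 \<noteq> 0 \<or> b V3 \<noteq> 0 \<or> b V4 \<noteq> 0 \<or> b V5 \<noteq> 0"
    unfolding fun_eq_iff all_X6_vertex by blast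
  \<comment> \<open>As \<open>b V4\<close> is nonnegative, \<open>c V4 \<le> 0\<close> forces
    \<open>b V4 = 0\<close> and \<open>b V0 \<le> 0\<close>; likewise \<open>d V2 \<le> 0\<close>
    forces \<open>b V2 = 0\<close>. Then \<open>c V4 = 0\<close>, so \<open>c V5 = 0\<close>, which
    reads \<open>b V5 = - 2 * b V0\<close>, and \<open>b V0 = 0\<close> would make \<open>b\<close>
    vanish.\<close>
  ultimately show "b V5 = - 2 * b V0 \<and> - 2 * b V0 > 0 \<and> b V1 = 0 \<and> b V2 = 0 \<and> b V3 = 0 \<and> b V4 = 0"
    using 12 34 by linarith
next
  assume b: "b V5 = - 2 * b V0 \<and> - 2 * b V0 > 0 \<and> b V1 = 0 \<and> b V2 = 0 \<and> b V3 = 0 \<and> b V4 = 0"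
  \<comment> \<open>The positive integer \<open>- b V0\<close> is the factor by which
    \<open>b\<close> exceeds the vector defining \<open>X7\<close>.\<close>
  then have "b = (\<lambda>i. (- b V0) * X7_row i)"
    unfolding fun_eq_iff all_X6_vertex by (simp add: X7_row_def)
  moreover have "finite (mutation_class (range Some) (add_frozen X6 (\<lambda>i. (- b V0) * X7_row i)))"
    using b finite_mutation_class_X7
    by (intro finite_mutation_class_add_frozen_scale is_quiver_X6) (simp_all add: X7_def)
  moreover have "b \<noteq> (\<lambda>_. 0)" using b by auto
  ultimately show "admissible X6 b" unfolding admissible_def by metis
qed

end
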